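(* Let $d\ge1$ be an integer, $n\ge1$, and write $z=u/(1+u)^2$. For $r\ge0$, the $d$th factorial moments of $X_{n,r}$ and $L_{n,r}$ are $$\mathbb{E}X_{n,r}^{\underline d}=\frac{1}{C_{n-1}}[z^n]\frac{\partial^d}{\partial v^d}G_r(z,v)\Big|_{v=1}=\frac1{C_{n-1}}[z^n]\frac{u^d\,d!}{(1+u)(1-u^{r+1})^d(1-u)^{d-1}}\tilde N_{d-1}(u^r)$$ and $$\mathbb{E}L_{n,r}^{\underline d}=\frac1{C_{n-1}}[z^n]\frac{u^{dr+2d}(1-u)\,d!}{(1+u)(1-u^{r+2})^d(1-u^{r+1})^d}\tilde N_{d-1}\Bigl(\frac1u\Bigr).$$ Moreover $\mathbb{E}I_{n,r-1}^{\underline d}=\mathbb{E}X_{n,r}^{\underline d}$ for $r\ge1$.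
   Context: A plane tree is a finite rooted tree in which the children of every node are linearly ordered; its size is its number of nodes. There are $C_{n-1}$ plane trees of size $n$, where $C_m=\frac1{m+1}\binom{2m}{m}$. A leaf is a node without children (the single-node tree consists of one leaf); all other nodes are inner nodes. For a plane tree $\tau$ with at least two nodes, $\rho(\tau)$ is obtained by simultaneously deleting all leaves of $\tau$; $\rho$ is not defined on the single-node tree. Let $\tau$ be uniformly random among all plane trees of size $n$. $X_{n,r}$, $I_{n,r}$, $L_{n,r}$ denote the size, the number of inner nodes, and the number of leaves of $\rho^r(\tau)$, respectively (all $0$ if $\rho^r(\tau)$ is not defined). $G_r(z,v)=\sum_\tau z^{|\tau|}v^{|\rho^r(\tau)|}$, summed over all plane trees $\tau$ for which $\rho^r(\tau)$ is defined. Associated Narayana polynomials: $\tilde N_0(x)=x$ and $\tilde N_m(x)=\sum_{k=1}^m\frac1m\binom{m}{k-1}\binom mk x^k$ for $m\ge1$. The substitution $z=u/(1+u)^2$ means that $u=u(z)$ is the power series in $z$ with $u(0)=0$ satisfying this equation; expressions in $u$ are viewed as power series in $z$ and $[z^n]$ extracts the coefficient of $z^n$. Falling factorial: $x^{\underline d}=x(x-1)\cdots(x-d+1)$. *)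

theory Defs
  imports "HOL-Probability.Probability" "HOL-Computational_Algebra.Computational_Algebra"
begin

datatype ptree = Node (children: "ptree list")

definition is_leaf :: "ptree \<Rightarrow> bool" where
  "is_leaf t \<longleftrightarrow> children t = []"

text \<open>The size of a plane tree is its number of nodes; the function \<open>size\<close> generated by the
  datatype package also counts list constructors and is not used.\<close>

fun nodes :: "ptree \<Rightarrow> nat" where
  "nodes (Node ts) = 1 + (\<Sum>t\<leftarrow>ts. nodes t)"

fun leaves :: "ptree \<Rightarrow> nat" where
  "leaves (Node ts) = (if ts = [] then 1 else (\<Sum>t\<leftarrow>ts. leaves t))"

fun inner_nodes :: "ptree \<Rightarrow> nat" where
  "inner_nodes (Node ts) = (if ts = [] then 0 else 1 + (\<Sum>t\<leftarrow>ts. inner_nodes t))"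

text \<open>\<open>prune t\<close> removes all leaves of \<open>t\<close> except that it always keeps the root; it is used
  only for trees whose root is not a leaf. The value \<open>None\<close> means ``not defined''.\<close>

fun prune :: "ptree \<Rightarrow> ptree" where
  "prune (Node ts) = Node (map prune (filter (\<lambda>t. \<not> is_leaf t) ts))"

definition rho :: "ptree \<Rightarrow> ptree option" where
  "rho t = (if is_leaf t then None else Some (prune t))"

fun rho_iter :: "nat \<Rightarrow> ptree \<Rightarrow> ptree option" where
  "rho_iter 0 t = Some t"
| "rho_iter (Suc r) t = Option.bind (rho_iter r t) rho"

definition plane_trees :: "nat \<Rightarrow> ptree set" where
  "plane_trees n = {t. nodes t = n}"

lemma plane_trees_Suc_subset:
  "plane_trees (Suc n) \<subseteq>
    Node ` {ts. set ts \<subseteq> (\<Union>k\<le>n. plane_trees k) \<and> length ts \<le> n}"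
proof
  fix t assume "t \<in> plane_trees (Suc n)"
  then obtain ts where t: "t = Node ts" and s: "(\<Sum>t\<leftarrow>ts. nodes t) = n"
    by (cases t) (auto simp: plane_trees_def)
  have "nodes x \<le> n" if "x \<in> set ts" for x
    using member_le_sum_list[of "nodes x" "map nodes ts"] that s by auto
  moreover have "length ts \<le> (\<Sum>t\<leftarrow>ts. nodes t)"
  proof (induction ts)
    case (Cons a ts)
    then show ?case by (cases a) auto
  qed simp
  ultimately show "t \<in> Node ` {ts. set ts \<subseteq> (\<Union>k\<le>n. plane_trees k) \<and> length ts \<le> n}"
    using t s by (auto simp: plane_trees_def)
qed

text \<open>Finiteness and non-emptiness ensure that \<open>pmf_of_set\<close> and the sums below are meaningful.\<close>

lemma finite_plane_trees: "finite (plane_trees n)"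
proof (induction n rule: less_induct)
  case (less n)
  show ?case
  proof (cases n)
    case 0
    have "nodes t \<noteq> 0" for t by (cases t) auto
    then have "plane_trees 0 = {}" by (auto simp: plane_trees_def)
    then show ?thesis using 0 by simp
  next
    case (Suc m)
    then have "finite (\<Union>k\<le>m. plane_trees k)" using less by auto
    then show ?thesis
      using finite_subset[OF plane_trees_Suc_subset[of m]] finite_lists_length_le Suc by blast
  qed
qed

lemma plane_trees_nonempty: "n \<ge> 1 \<Longrightarrow> plane_trees n \<noteq> {}"
proof -
  assume "n \<ge> 1"
  then have "Node (replicate (n - 1) (Node [])) \<in> plane_trees n"
    by (simp add: plane_trees_def sum_list_replicate)
  then show ?thesis by blast
qed

definition random_plane_tree :: "nat \<Rightarrow> ptree pmf" where
  "random_plane_tree n = pmf_of_set (plane_trees n)"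

text \<open>\<open>X\<^sub>n\<^sub>,\<^sub>r\<close>, \<open>I\<^sub>n\<^sub>,\<^sub>r\<close> and \<open>L\<^sub>n\<^sub>,\<^sub>r\<close> as functions of the sample \<open>t\<close>;
  the dependence on \<open>n\<close> is only through the distribution \<open>random_plane_tree n\<close>.\<close>

definition X_rv :: "nat \<Rightarrow> ptree \<Rightarrow> nat" where
  "X_rv r t = (case rho_iter r t of None \<Rightarrow> 0 | Some s \<Rightarrow> nodes s)"

definition I_rv :: "nat \<Rightarrow> ptree \<Rightarrow> nat" where
  "I_rv r t = (case rho_iter r t of None \<Rightarrow> 0 | Some s \<Rightarrow> inner_nodes s)"

definition L_rv :: "nat \<Rightarrow> ptree \<Rightarrow> nat" where
  "L_rv r t = (case rho_iter r t of None \<Rightarrow> 0 | Some s \<Rightarrow> leaves s)"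

definition falling_factorial :: "real \<Rightarrow> nat \<Rightarrow> real" where
  "falling_factorial x d = (\<Prod>i<d. x - real i)"

definition factorial_moment :: "nat \<Rightarrow> nat \<Rightarrow> (ptree \<Rightarrow> nat) \<Rightarrow> real" where
  "factorial_moment d n Y =
     measure_pmf.expectation (random_plane_tree n) (\<lambda>t. falling_factorial (real (Y t)) d)"

definition catalan :: "nat \<Rightarrow> real" where
  "catalan m = real ((2 * m) choose m) / real (m + 1)"

text \<open>\<open>G r\<close> is a power series in \<open>z\<close> whose coefficients are polynomials in \<open>v\<close>; the partial
  derivative in \<open>v\<close> and the evaluation at a value of \<open>v\<close> act on it coefficientwise.\<close>

definition G :: "nat \<Rightarrow> real poly fps" where
  "G r = Abs_fps (\<lambda>n. \<Sum>t \<in> {t \<in> plane_trees n. rho_iter r t \<noteq> None}.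
           monom 1 (nodes (the (rho_iter r t))))"

definition deriv_v :: "real poly fps \<Rightarrow> real poly fps" where
  "deriv_v F = Abs_fps (\<lambda>n. pderiv (fps_nth F n))"

definition eval_v :: "real poly fps \<Rightarrow> real \<Rightarrow> real fps" where
  "eval_v F a = Abs_fps (\<lambda>n. poly (fps_nth F n) a)"

definition assoc_narayana :: "nat \<Rightarrow> real poly" where
  "assoc_narayana m =
     (if m = 0 then monom 1 1
      else (\<Sum>k=1..m. monom (1 / real m * real (m choose (k - 1)) * real (m choose k)) k))"

text \<open>Evaluation of a real polynomial at a power series, respectively at a Laurent series. The
  latter is needed for arguments such as \<open>1/u\<close> with \<open>u\<close> of zero constant term. (Composition of
  power series would not be adequate, since \<open>u ^ 0\<close> has a non-zero constant term.)\<close>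

definition poly_fps :: "real poly \<Rightarrow> real fps \<Rightarrow> real fps" where
  "poly_fps p f = poly (map_poly fps_const p) f"

definition poly_fls :: "real poly \<Rightarrow> real fls \<Rightarrow> real fls" where
  "poly_fls p f = poly (map_poly fls_const p) f"

definition u_substitution :: "real fps \<Rightarrow> bool" where
  "u_substitution u \<longleftrightarrow> fps_nth u 0 = 0 \<and> fps_X = u / (1 + u)\<^sup>2"

lemma u_substitution_ex1: "\<exists>!u. u_substitution u"
proof (rule ex_ex1I)
  define A :: "real fps" where "A = fps_X / (1 + fps_X)\<^sup>2"
  define u where "u = fps_inv A"
  have A': "A = fps_X * inverse ((1 + fps_X)\<^sup>2)"
    unfolding A_def by (rule fps_divide_unit) simp
  have A0: "fps_nth A 0 = 0" and A1: "fps_nth A 1 \<noteq> 0"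
    by (simp_all add: A')
  have u0: "fps_nth u 0 = 0"
    by (simp add: u_def fps_inv_def)
  have "A * (1 + fps_X)\<^sup>2 = fps_X"
    using inverse_mult_eq_1[of "(1 + fps_X :: real fps)\<^sup>2"] by (simp add: A' mult.assoc)
  then have "(A * (1 + fps_X)\<^sup>2) oo u = u"
    using u0 by simp
  moreover have "A oo u = fps_X"
    unfolding u_def using A0 A1 by (rule fps_inv_right)
  moreover have "(1 + fps_X)\<^sup>2 oo u = (1 + u)\<^sup>2"
    using u0 by (simp add: power2_eq_square fps_compose_mult_distrib fps_compose_add_distrib)
  ultimately have "fps_X * (1 + u)\<^sup>2 = u"
    using u0 by (simp add: fps_compose_mult_distrib)
  then have "fps_X = u / (1 + u)\<^sup>2"
    using u0 inverse_mult_eq_1'[of "(1 + u)\<^sup>2"]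
    by (subst fps_divide_unit) (auto, metis mult.assoc mult.right_neutral)
  then show "\<exists>u. u_substitution u"
    using u0 unfolding u_substitution_def by blast
next
  fix u w assume uw: "u_substitution u" "u_substitution w"
  have eq: "fps_X * (1 + f)\<^sup>2 = f" if "u_substitution f" for f
  proof -
    have c: "fps_nth ((1 + f)\<^sup>2) 0 \<noteq> 0"
      using that by (simp add: u_substitution_def)
    have X: "fps_X = f * inverse ((1 + f)\<^sup>2)"
      using that fps_divide_unit[OF c] by (simp add: u_substitution_def)
    have "fps_X * (1 + f)\<^sup>2 = f * (inverse ((1 + f)\<^sup>2) * (1 + f)\<^sup>2)"
      by (subst X) (rule mult.assoc)
    then show ?thesis
      by (simp only: inverse_mult_eq_1[OF c] mult_1_right)
  qed
  have "(u - w) * (1 - fps_X * (2 + u + w)) = 0"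
  proof -
    have "(u - w) * (1 - fps_X * (2 + u + w)) =
            (u - w) - (fps_X * (1 + u)\<^sup>2 - fps_X * (1 + w)\<^sup>2)"
      by (simp add: power2_eq_square algebra_simps)
    then show ?thesis using eq[OF uw(1)] eq[OF uw(2)] by simp
  qed
  moreover have "1 - fps_X * (2 + u + w) \<noteq> 0"
  proof
    assume "1 - fps_X * (2 + u + w) = 0"
    then have "fps_nth (1 - fps_X * (2 + u + w)) 0 = 0" by simp
    then show False by simp
  qed
  ultimately show "u = w" by simp
qed

end

theory Submission
  imports Defs
begin

text \<open>
  The variable \<open>v\<close> is followed through the decomposition of a plane tree at its root. Deleting leaves
  acts on the subtrees of the root separately, so that \<open>\<rho>\<^sup>r\<close> of a tree, if defined, is a root over the
  trees \<open>\<rho>\<^sup>r(c)\<close> for those subtrees \<open>c\<close> of the root for which they are defined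
  (\<open>rho_iter_Node\<close>). Give a tree the weight \<open>v\<^sup>X\<close>, where \<open>X\<close> is the size of its \<open>r\<close>th reduction, or 0 if
  there is none. Up to a correction at the root, this weight is the product of the weights of
  the subtrees, and trees weighted by such a product have the generating function \<open>z / (1 - Y)\<close>
  (\<open>tree_gf_node\<close>), where \<open>Y\<close> is the generating function for the weight itself. Hence
  \<open>Y = v z / (1 - Y) + (1 - v) B\<^sub>r\<close>, where \<open>B\<^sub>r\<close> enumerates the trees whose \<open>r\<close>th reduction is undefined.
  Similarly, if \<open>v\<close> marks the leaves of the reduction, then
  \<open>Y = z / (1 - Y) + (v - 1) (B\<^sub>r\<^sub>+\<^sub>1 - B\<^sub>r)\<close>. The recursion \<open>B\<^sub>r\<^sub>+\<^sub>1 = z / (1 - B\<^sub>r)\<close> gives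
  \<open>B\<^sub>r = (u - u\<^sup>r\<^sup>+\<^sup>1) / ((1 + u) (1 - u\<^sup>r\<^sup>+\<^sup>1))\<close>.

  With \<open>v = 1 + w\<close>, the coefficient of \<open>w\<^sup>d\<close> in \<open>Y\<close> is the generating function of the \<open>d\<close>th binomial moments,
  and both equations become quadratic equations over power series in \<open>w\<close>. An equation of the same
  kind holds for the Narayana generating function \<open>M = \<Sum>d\<ge>1. y\<^sup>d N\<^sub>d\<^sub>-\<^sub>1(x) w\<^sup>d\<close>, namely
  \<open>M (1 - M) = w x y + w y (1 - x) M\<close> (\<open>narayana_gf_quadratic\<close>). At \<open>w = 0\<close> the solution is
  \<open>u / (1 + u)\<close>, and the difference of the two roots is \<open>(1 - u) / (1 + u)\<close>. Therefore
  \<open>Y = u / (1 + u) + (1 - u) / (1 + u) M\<close> for suitable \<open>x\<close> and \<open>y\<close>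
  (\<open>quadratic_solution_narayana\<close>): for the size, \<open>x = u\<^sup>r\<close> and \<open>y = u / ((1 - u\<^sup>r\<^sup>+\<^sup>1) (1 - u))\<close>; for the leaves,
  \<open>x = 1 / u\<close> and \<open>y = u\<^sup>r\<^sup>+\<^sup>2 / ((1 - u\<^sup>r\<^sup>+\<^sup>2) (1 - u\<^sup>r\<^sup>+\<^sup>1))\<close>. The formulas are the coefficients of \<open>w\<^sup>d\<close>,
  multiplied by \<open>d!\<close>. The statement about inner nodes holds tree by tree, because the
  inner nodes of a tree are the nodes that the next deletion keeps.
\<close>

section \<open>Generating functions of plane trees\<close>

definition tree_gf :: "(ptree \<Rightarrow> 'a::comm_ring_1) \<Rightarrow> 'a fps" where
  "tree_gf g = Abs_fps (\<lambda>n. \<Sum>t\<in>plane_trees n. g t)"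

definition forests :: "nat \<Rightarrow> ptree list set" where
  "forests n = {ts. (\<Sum>t\<leftarrow>ts. nodes t) = n}"

lemma plane_trees_0 [simp]: "plane_trees 0 = {}"
proof -
  have "nodes t \<noteq> 0" for t by (cases t) auto
  then show ?thesis by (auto simp: plane_trees_def)
qed

lemma plane_trees_Suc: "plane_trees (Suc n) = Node ` forests n"
proof
  show "plane_trees (Suc n) \<subseteq> Node ` forests n"
  proof
    fix t assume "t \<in> plane_trees (Suc n)"
    then show "t \<in> Node ` forests n"
      by (cases t) (auto simp: plane_trees_def forests_def)
  qed
qed (auto simp: plane_trees_def forests_def)

lemma finite_forests: "finite (forests n)"
proof (rule finite_imageD)
  show "finite (Node ` forests n)"
    using finite_plane_trees[of "Suc n"] by (simp add: plane_trees_Suc)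
qed (auto simp: inj_on_def)

text \<open>Symbolically \<open>P = z / (1 - Y)\<close>: a plane tree is a root followed by a sequence of plane
  trees, and the weight is multiplicative over that sequence. All functional equations below are
  instances of this one, for different weights \<open>g\<close>.\<close>

lemma tree_gf_node:
  fixes g :: "ptree \<Rightarrow> 'a::comm_ring_1"
  shows "tree_gf (\<lambda>t. \<Prod>c\<leftarrow>children t. g c) * (1 - tree_gf g) = fps_X"
proof -
  \<comment> \<open>The generating function of forests is \<open>1 / (1 - tree_gf g)\<close>: a forest is empty or
    consists of a first tree and a remaining forest.\<close>
  define L where "L = Abs_fps (\<lambda>n. \<Sum>ts\<in>forests n. \<Prod>c\<leftarrow>ts. g c)"
  have split: "forests n = (if n = 0 then {[]} else {}) \<union>
      (\<lambda>(t, ts). t # ts) ` (SIGMA t:(\<Union>i\<le>n. plane_trees i). forests (n - nodes t))" for n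
  proof (rule set_eqI)
    fix ts :: "ptree list"
    show "ts \<in> forests n \<longleftrightarrow> ts \<in> (if n = 0 then {[]} else {}) \<union>
      (\<lambda>(t, ts). t # ts) ` (SIGMA t:(\<Union>i\<le>n. plane_trees i). forests (n - nodes t))"
      by (cases ts) (auto simp: forests_def plane_trees_def)
  qed
  have "L = 1 + tree_gf g * L"
  proof (rule fps_ext)
    fix n
    let ?P = "\<lambda>ts. \<Prod>c\<leftarrow>ts. g c"
    let ?S = "SIGMA t:(\<Union>i\<le>n. plane_trees i). forests (n - nodes t)"
    have fin: "finite ?S"
      by (intro finite_SigmaI finite_UN_I finite_plane_trees finite_forests) auto
    have "fps_nth L n = sum ?P (if n = 0 then {[]} else {}) + sum ?P ((\<lambda>(t, ts). t # ts) ` ?S)"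
      unfolding L_def fps_nth_Abs_fps
      by (subst split, rule sum.union_disjoint) (use fin in auto)
    also have "sum ?P ((\<lambda>(t, ts). t # ts) ` ?S) = (\<Sum>(t, ts)\<in>?S. g t * ?P ts)"
      by (subst sum.reindex) (auto simp: inj_on_def intro!: sum.cong)
    also have "\<dots> = (\<Sum>t\<in>(\<Union>i\<le>n. plane_trees i). \<Sum>ts\<in>forests (n - nodes t). g t * ?P ts)"
      by (rule sum.Sigma [symmetric]) (auto simp: finite_plane_trees finite_forests)
    also have "\<dots> = (\<Sum>i\<le>n. \<Sum>t\<in>plane_trees i. \<Sum>ts\<in>forests (n - nodes t). g t * ?P ts)"
      by (rule sum.UNION_disjoint) (auto simp: finite_plane_trees, auto simp: plane_trees_def)
    also have "\<dots> = (\<Sum>i\<le>n. \<Sum>t\<in>plane_trees i. g t * fps_nth L (n - i))"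
      by (intro sum.cong refl) (auto simp: L_def sum_distrib_left plane_trees_def)
    also have "\<dots> = fps_nth (tree_gf g * L) n"
      by (simp add: fps_mult_nth tree_gf_def sum_distrib_right atLeast0AtMost)
    finally show "fps_nth L n = fps_nth (1 + tree_gf g * L) n"
      by simp
  qed
  then have L: "L * (1 - tree_gf g) = 1"
    by (simp add: algebra_simps)
  \<comment> \<open>The factor \<open>fps_X\<close> accounts for the root.\<close>
  have "tree_gf (\<lambda>t. \<Prod>c\<leftarrow>children t. g c) = fps_X * L"
  proof (rule fps_ext)
    fix n
    show "fps_nth (tree_gf (\<lambda>t. \<Prod>c\<leftarrow>children t. g c)) n = fps_nth (fps_X * L) n"
    proof (cases n)
      case (Suc m)
      then show ?thesis
        by (simp add: tree_gf_def L_def plane_trees_Suc sum.reindex inj_on_def)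
    qed (simp add: tree_gf_def)
  qed
  then show ?thesis using L by (simp add: mult.assoc)
qed

lemma tree_gf_one: "tree_gf (\<lambda>_. 1) * (1 - tree_gf (\<lambda>_. 1)) = (fps_X :: 'a::comm_ring_1 fps)"
  using tree_gf_node[of "\<lambda>_. 1 :: 'a"] by (simp add: map_replicate_const)

lemma tree_gf_lincomb:
  assumes "\<And>t. f t = a * g t + b * h t"
  shows "tree_gf f = fps_const a * tree_gf g + fps_const b * tree_gf h"
  by (rule fps_ext) (simp add: tree_gf_def assms sum.distrib sum_distrib_left)

section \<open>Iterated leaf deletion on the subtrees of the root\<close>

text \<open>Equivalently, the height of \<open>t\<close> (in edges) is less than \<open>r\<close>.\<close>

abbreviation (input) vanishes :: "nat \<Rightarrow> ptree \<Rightarrow> bool" where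
  "vanishes r t \<equiv> rho_iter r t = None"

lemma map_filter_map_filter_bind:
  "List.map_filter f (List.map_filter g xs) = List.map_filter (\<lambda>x. Option.bind (g x) f) xs"
  by (induction xs) (auto split: option.split)

lemma set_map_filter: "y \<in> set (List.map_filter f xs) \<longleftrightarrow> (\<exists>x\<in>set xs. f x = Some y)"
  by (induction xs) (auto split: option.split)

lemma map_filter_eq_Nil_iff: "List.map_filter f xs = [] \<longleftrightarrow> (\<forall>x\<in>set xs. f x = None)"
  by (induction xs) (auto split: option.split)

lemma sum_list_map_filter: "sum_list (map h (List.map_filter f xs)) =
    (\<Sum>x\<leftarrow>xs. case f x of None \<Rightarrow> 0 | Some y \<Rightarrow> (h y :: nat))"
  by (induction xs) (auto split: option.split)

lemma rho_Node: "rho (Node ts) = (if ts = [] then None else Some (Node (List.map_filter rho ts)))"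
proof -
  have "map prune (filter (\<lambda>t. \<not> is_leaf t) ts) = List.map_filter rho ts"
    by (induction ts) (auto simp: rho_def)
  then show ?thesis by (simp add: rho_def is_leaf_def)
qed

text \<open>Performing the first deletion first, instead of the last one last, gives the recursion that fits
  induction on \<open>r\<close> for all forests simultaneously.\<close>

lemma rho_iter_Suc_left: "rho_iter (Suc r) t = Option.bind (rho t) (rho_iter r)"
proof (induction r)
  case (Suc r)
  have "rho_iter (Suc (Suc r)) t = Option.bind (rho_iter (Suc r) t) rho"
    by simp
  also have "\<dots> = Option.bind (Option.bind (rho t) (rho_iter r)) rho"
    by (simp only: Suc)
  also have "\<dots> = Option.bind (rho t) (rho_iter (Suc r))"
    by (cases "rho t") auto
  finally show ?case .
qed (cases "rho t"; simp)

declare rho_iter.simps(2) [simp del]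

lemma rho_iter_Suc_None_iff: "vanishes (Suc r) (Node ts) \<longleftrightarrow> (\<forall>t\<in>set ts. vanishes r t)"
proof (induction r arbitrary: ts)
  case 0
  then show ?case by (cases ts) (auto simp: rho_iter_Suc_left rho_Node)
next
  case (Suc r)
  have "vanishes (Suc (Suc r)) (Node ts) \<longleftrightarrow>
      (\<forall>s\<in>set (List.map_filter rho ts). vanishes r s)"
    using Suc.IH[of "List.map_filter rho ts"]
    by (subst rho_iter_Suc_left) (simp add: rho_Node)
  also have "\<dots> \<longleftrightarrow> (\<forall>t\<in>set ts. vanishes (Suc r) t)"
    by (auto simp: set_map_filter rho_iter_Suc_left split: bind_split)
  finally show ?case .
qed

lemma vanishes_Suc: "vanishes r t \<Longrightarrow> vanishes (Suc r) t"
  by (simp add: rho_iter.simps)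

lemma vanishes_children: "vanishes r (Node ts) \<Longrightarrow> t \<in> set ts \<Longrightarrow> vanishes r t"
  by (cases r) (auto simp: rho_iter_Suc_None_iff intro: vanishes_Suc)

text \<open>Deleting leaves acts on each subtree of the root separately, and a subtree disappears exactly
  when it would have to lose its own root. Thus all statistics of \<open>rho_iter r\<close> become additive
  over the children, up to a contribution of the root.\<close>

lemma rho_iter_Node:
  assumes "\<not> vanishes r (Node ts)"
  shows "rho_iter r (Node ts) = Some (Node (List.map_filter (rho_iter r) ts))"
  using assms
proof (induction r arbitrary: ts)
  case 0
  have "List.map_filter Some ts = ts" by (induction ts) auto
  then show ?case by (simp add: rho_iter.simps(1) [abs_def])
next
  case (Suc r)
  then have ts: "ts \<noteq> []" and nv: "\<not> vanishes r (Node (List.map_filter rho ts))"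
    by (auto simp: rho_iter_Suc_left rho_Node split: if_splits)
  have "rho_iter (Suc r) (Node ts) = rho_iter r (Node (List.map_filter rho ts))"
    using ts by (simp add: rho_iter_Suc_left rho_Node)
  also have "\<dots> = Some (Node (List.map_filter (rho_iter r) (List.map_filter rho ts)))"
    by (rule Suc.IH [OF nv])
  also have "List.map_filter (rho_iter r) (List.map_filter rho ts) =
      List.map_filter (rho_iter (Suc r)) ts"
    unfolding map_filter_map_filter_bind by (simp add: rho_iter_Suc_left [abs_def])
  finally show ?case .
qed

lemma X_rv_Node:
  "X_rv r (Node ts) = (if vanishes r (Node ts) then 0 else 1) + (\<Sum>t\<leftarrow>ts. X_rv r t)"
proof (cases "vanishes r (Node ts)")
  case True
  then have "map (X_rv r) ts = map (\<lambda>_. 0) ts"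
    using vanishes_children by (auto simp: X_rv_def)
  then show ?thesis using True by (simp add: X_rv_def [of r "Node ts"])
next
  case False
  then show ?thesis
    using rho_iter_Node[OF False] by (simp add: X_rv_def sum_list_map_filter)
qed

text \<open>The root is a leaf of the reduced tree precisely when all its subtrees have disappeared but the
  root itself has not.\<close>

lemma L_rv_Node:
  "L_rv r (Node ts) = (if vanishes (Suc r) (Node ts) \<and> \<not> vanishes r (Node ts) then 1 else 0)
     + (\<Sum>t\<leftarrow>ts. L_rv r t)"
proof (cases "vanishes r (Node ts)")
  case True
  then have "map (L_rv r) ts = map (\<lambda>_. 0) ts"
    using vanishes_children by (auto simp: L_rv_def)
  then show ?thesis using True by (simp add: L_rv_def [of r "Node ts"])
next
  case False
  have L: "L_rv r (Node ts) = leaves (Node (List.map_filter (rho_iter r) ts))"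
    using rho_iter_Node[OF False] by (simp add: L_rv_def)
  show ?thesis
  proof (cases "vanishes (Suc r) (Node ts)")
    case True
    then have *: "\<forall>t\<in>set ts. vanishes r t" by (simp add: rho_iter_Suc_None_iff)
    then have "map (L_rv r) ts = map (\<lambda>_. 0) ts" by (auto simp: L_rv_def)
    then show ?thesis using * True False L by (simp add: map_filter_eq_Nil_iff)
  next
    case nv: False
    then have "List.map_filter (rho_iter r) ts \<noteq> []"
      by (simp add: rho_iter_Suc_None_iff map_filter_eq_Nil_iff)
    then have "L_rv r (Node ts) = (\<Sum>t\<leftarrow>ts. L_rv r t)"
      using L by (simp only: leaves.simps if_False sum_list_map_filter L_rv_def [abs_def])
    then show ?thesis using nv by simp
  qed
qed

text \<open>The inner nodes are those that survive the deletion of the leaves.\<close>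

lemma nodes_prune: "\<not> is_leaf t \<Longrightarrow> nodes (prune t) = inner_nodes t"
proof (induction t)
  case (Node ts)
  have "(\<Sum>t\<leftarrow>filter (\<lambda>t. \<not> is_leaf t) ts. nodes (prune t)) = (\<Sum>t\<leftarrow>ts. inner_nodes t)"
    using Node.IH
  proof (induction ts)
    case (Cons a ts)
    have "inner_nodes a = 0" if "is_leaf a" using that by (cases a) (auto simp: is_leaf_def)
    then show ?case using Cons by auto
  qed simp
  then show ?case using Node.prems by (simp add: is_leaf_def o_def)
qed

text \<open>If \<open>rho_iter r t\<close> is a single leaf, then both sides are 0: there is no inner node, and the
  next reduction is undefined.\<close>

lemma I_rv_eq_X_rv: "I_rv r t = X_rv (Suc r) t"
proof (cases "rho_iter r t")
  case (Some s)
  show ?thesis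
  proof (cases "is_leaf s")
    case True
    then show ?thesis using Some
      by (cases s) (simp add: I_rv_def X_rv_def rho_iter.simps rho_def is_leaf_def)
  next
    case False
    then show ?thesis using Some
      by (simp add: I_rv_def X_rv_def rho_iter.simps rho_def nodes_prune)
  qed
qed (simp add: I_rv_def X_rv_def rho_iter.simps)

definition vanish_gf :: "nat \<Rightarrow> 'a::comm_ring_1 fps" where
  "vanish_gf r = tree_gf (\<lambda>t. of_bool (vanishes r t))"

lemma vanish_gf_0: "vanish_gf 0 = 0"
  by (simp add: vanish_gf_def tree_gf_def fps_eq_iff)

text \<open>A tree vanishes in \<open>r + 1\<close> steps if and only if all subtrees of its root vanish in \<open>r\<close> steps, so
  the indicator is multiplicative over the children.\<close>

lemma vanish_gf_Suc: "vanish_gf (Suc r) * (1 - vanish_gf r) = (fps_X :: 'a::comm_ring_1 fps)"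
proof -
  have prod: "(\<Prod>t\<leftarrow>ts. of_bool (Q t)) = (of_bool (\<forall>t\<in>set ts. Q t) :: 'a)" for Q and ts :: "ptree list"
    by (induction ts) auto
  have "(\<Prod>c\<leftarrow>children t. of_bool (vanishes r c)) = (of_bool (vanishes (Suc r) t) :: 'a)" for t
    by (cases t) (simp only: ptree.sel prod rho_iter_Suc_None_iff)
  then show ?thesis
    using tree_gf_node[of "\<lambda>t. of_bool (vanishes r t) :: 'a"] by (simp add: vanish_gf_def)
qed

section \<open>Square roots of quadratic polynomials and the Catalan numbers\<close>

text \<open>In the coefficients, the highest index on the left exceeds the highest one on the right, and
  its factor is a nonzero integer.\<close>

lemma fps_linear_ode_zero:
  fixes Z D E :: "'a::{idom,ring_char_0} fps"
  assumes ode: "D * fps_deriv Z = E * Z" and D0: "fps_nth D 0 = 1" and Z0: "fps_nth Z 0 = 0"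
  shows "Z = 0"
proof -
  have "fps_nth Z n = 0" for n
  proof (induction n rule: less_induct)
    case (less n)
    show ?case
    proof (cases n)
      case 0
      then show ?thesis using Z0 by simp
    next
      case (Suc m)
      have "fps_nth (E * Z) m = 0"
        unfolding fps_mult_nth using less Suc by (intro sum.neutral) auto
      moreover have "fps_nth (D * fps_deriv Z) m = of_nat (Suc m) * fps_nth Z (Suc m)"
      proof -
        have "fps_nth (D * fps_deriv Z) m =
            (\<Sum>i\<in>{0..m}. if i = 0 then of_nat (Suc m) * fps_nth Z (Suc m) else 0)"
          unfolding fps_mult_nth using less Suc D0
          by (intro sum.cong refl) auto
        then show ?thesis by simp
      qed
      ultimately show ?thesis using ode Suc by (simp del: of_nat_Suc)
    qed
  qed
  then show ?thesis by (simp add: fps_eq_iff)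
qed

text \<open>The recurrence says that \<open>V\<close> satisfies the differential equation \<open>2 D V' = D' V\<close> of \<open>sqrt D\<close>,
  where \<open>D = 1 - 2 s w + t w\<^sup>2\<close>. Then \<open>V\<^sup>2 - D\<close> satisfies \<open>D Z' = D' Z\<close> with \<open>Z(0) = 0\<close>, and hence is 0.
  In this way a quadratic equation can be derived from closed forms of the coefficients,
  without evaluating a convolution.\<close>

lemma fps_square_of_recurrence:
  fixes V :: "'a::{idom,ring_char_0} fps"
  assumes V0: "fps_nth V 0 = 1" and V1: "fps_nth V 1 = - s"
    and rec: "\<And>n. of_nat (n + 2) * fps_nth V (n + 2) =
      s * of_nat (2 * n + 1) * fps_nth V (n + 1) - t * (of_nat n - 1) * fps_nth V n"
  shows "V\<^sup>2 = 1 - fps_const (2 * s) * fps_X + fps_const t * fps_X\<^sup>2"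
proof -
  define D where "D = 1 - fps_const (2 * s) * fps_X + fps_const t * fps_X\<^sup>2"
  define Z where "Z = V\<^sup>2 - D"
  have D': "fps_deriv D = fps_const (2 * t) * fps_X - fps_const (2 * s)"
    by (simp add: D_def power2_eq_square fps_eq_iff algebra_simps numeral_fps_const)
  \<comment> \<open>The recurrence, read coefficient by coefficient.\<close>
  have lin: "2 * D * fps_deriv V = fps_deriv D * V"
  proof (rule fps_ext)
    fix n
    have L: "2 * D * fps_deriv V = fps_const 2 * fps_deriv V
        - fps_const (4 * s) * (fps_X * fps_deriv V)
        + fps_const (2 * t) * (fps_X * (fps_X * fps_deriv V))"
      by (simp add: D_def algebra_simps power2_eq_square numeral_fps_const
        flip: fps_const_mult)
    have R: "fps_deriv D * V = fps_const (2 * t) * (fps_X * V) - fps_const (2 * s) * V"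
      by (simp add: D' algebra_simps)
    consider "n = 0" | m where "n = Suc m" by (cases n) auto
    then show "fps_nth (2 * D * fps_deriv V) n = fps_nth (fps_deriv D * V) n"
    proof cases
      case 1
      then show ?thesis unfolding L R using V0 V1 by simp
    next
      case (2 m)
      have "fps_nth (2 * D * fps_deriv V) n =
          2 * (of_nat (m + 2) * fps_nth V (m + 2))
          - 4 * s * of_nat (m + 1) * fps_nth V (m + 1) + 2 * t * of_nat m * fps_nth V m"
        unfolding L using 2 by (cases m) (auto simp: algebra_simps)
      also have "\<dots> = fps_nth (fps_deriv D * V) n"
        unfolding rec R using 2 by (simp add: algebra_simps)
      finally show ?thesis .
    qed
  qed
  have "D * fps_deriv Z = V * (2 * D * fps_deriv V) - D * fps_deriv D"
    by (simp add: Z_def power2_eq_square algebra_simps)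
  also have "\<dots> = fps_deriv D * Z"
    unfolding lin by (simp add: Z_def power2_eq_square algebra_simps)
  finally have "Z = 0"
    by (rule fps_linear_ode_zero) (simp_all add: D_def Z_def V0 power2_eq_square)
  then show ?thesis by (simp add: Z_def D_def)
qed

lemma catalan_Suc: "real (m + 2) * catalan (Suc m) = real (4 * m + 2) * catalan m"
proof -
  have "Suc (m + 0) * (Suc (m + m) choose Suc m) = Suc (m + m) * ((m + m) choose m)"
    using Suc_times_binomial[of m "m + m"] by simp
  then have a: "real (Suc m) * real (Suc (2 * m) choose Suc m) = real (2 * m + 1) * real ((2 * m) choose m)"
    by (simp only: of_nat_mult [symmetric] of_nat_eq_iff) (simp add: mult_2)
  have "Suc (2 * m) choose m = Suc (2 * m) choose Suc m"
    using binomial_symmetric[of m "Suc (2 * m)"] by (simp add: mult_2)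
  then have b: "(2 * Suc m) choose (Suc m) = 2 * (Suc (2 * m) choose Suc m)"
    by simp
  have "real (m + 2) * catalan (Suc m) = 2 * real (Suc (2 * m) choose Suc m)"
    unfolding catalan_def b by (simp add: field_simps)
  also have "\<dots> = real (4 * m + 2) * catalan m"
    using a by (simp add: catalan_def field_simps)
  finally show ?thesis .
qed

text \<open>The generating function of trees and that of the Catalan numbers satisfy the same quadratic
  equation \<open>T (1 - T) = z\<close>; for the Catalan numbers this is the case \<open>s = 2\<close>, \<open>t = 0\<close> of
  \<open>fps_square_of_recurrence\<close> with \<open>V = 1 - 2 C = sqrt (1 - 4 z)\<close>.\<close>

lemma card_plane_trees:
  assumes "n \<ge> 1"
  shows "real (card (plane_trees n)) = catalan (n - 1)"
proof -
  define T :: "real fps" where "T = tree_gf (\<lambda>_. 1)"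
  define C :: "real fps" where "C = Abs_fps (\<lambda>n. if n = 0 then 0 else catalan (n - 1))"
  have T: "T * (1 - T) = fps_X"
    unfolding T_def by (rule tree_gf_one)
  have "(1 - fps_const 2 * C)\<^sup>2 = 1 - fps_const (2 * 2) * fps_X + fps_const 0 * fps_X\<^sup>2"
  proof (rule fps_square_of_recurrence)
    fix n
    show "real (n + 2) * fps_nth (1 - fps_const 2 * C) (n + 2) =
        2 * real (2 * n + 1) * fps_nth (1 - fps_const 2 * C) (n + 1)
        - 0 * (real n - 1) * fps_nth (1 - fps_const 2 * C) n"
      using catalan_Suc[of n] by (simp add: C_def)
  qed (simp_all add: C_def catalan_def)
  then have "4 * (C * (1 - C)) = 4 * fps_X"
    by (simp add: power2_eq_square algebra_simps numeral_fps_const [symmetric])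
  then have C: "C * (1 - C) = fps_X" by simp
  \<comment> \<open>\<open>T\<close> and \<open>C\<close> solve the same quadratic equation; the other root has constant term 1.\<close>
  have "(T - C) * (1 - T - C) = T * (1 - T) - C * (1 - C)"
    by (simp add: algebra_simps)
  then have "(T - C) * (1 - T - C) = 0" using T C by simp
  moreover have "fps_nth (1 - T - C) 0 = 1" by (simp add: T_def C_def tree_gf_def)
  then have "1 - T - C \<noteq> 0" by auto
  ultimately have "T = C" by simp
  then have "fps_nth T n = fps_nth C n" by simp
  then show ?thesis using assms by (simp add: T_def C_def tree_gf_def)
qed

section \<open>Narayana polynomials and their quadratic equation\<close>

text \<open>The value at \<open>k = 0\<close> is fixed separately because \<open>k - 1\<close> is truncated there.\<close>

definition narayana :: "nat \<Rightarrow> nat \<Rightarrow> real" where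
  "narayana m k = (if k = 0 then 0 else real (m choose (k - 1)) * real (m choose k) / real m)"

lemma coeff_assoc_narayana: "m > 0 \<Longrightarrow> coeff (assoc_narayana m) k = narayana m k"
proof -
  assume m: "m > 0"
  have "coeff (assoc_narayana m) k =
      (\<Sum>j=1..m. if j = k then real (m choose (j - 1)) * real (m choose j) / real m else 0)"
    using m by (simp add: assoc_narayana_def coeff_sum coeff_monom)
  also have "\<dots> = narayana m k"
    by (auto simp: narayana_def binomial_eq_0)
  finally show ?thesis .
qed

text \<open>By Pascal's rule, all Narayana numbers involved are products of sums of the four binomial
  coefficients \<open>a\<close>, \<open>b\<close>, \<open>c\<close>, \<open>e\<close> of \<open>m\<close> over \<open>k - 1, \<dots>, k + 2\<close>, whose ratios are rational functions of \<open>m\<close>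
  and \<open>k\<close>. What remains is a polynomial identity.\<close>

lemma narayana_recurrence:
  fixes m k :: nat
  assumes "m > 0"
  shows "real (m + 3) * narayana (m + 2) (k + 2) =
    real (2 * m + 3) * (narayana (m + 1) (k + 2) + narayana (m + 1) (k + 1))
    - real m * (narayana m (k + 2) - 2 * narayana m (k + 1) + narayana m k)"
proof (cases k)
  \<comment> \<open>The general argument below divides by \<open>k\<close>, \<open>k + 1\<close> and \<open>k + 2\<close>.\<close>
  case 0
  have two: "real (n choose 2) = real n * (real n - 1) / 2" for n
    by (induction n) (auto simp: numeral_2_eq_2 field_simps)
  show ?thesis using assms 0
    by (simp add: narayana_def two field_simps)
next
  case (Suc j)
  define a b c e M where "a = real (m choose j)" and "b = real (m choose (j + 1))"
    and "c = real (m choose (j + 2))" and "e = real (m choose (j + 3))" and "M = real m"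
  \<comment> \<open>Ratios of neighbouring binomial coefficients, in a form that needs no upper bound on \<open>i\<close>.\<close>
  have rat: "real (Suc i) * real (m choose Suc i) = (M - real i) * real (m choose i)" for i
  proof (cases "i \<le> m")
    case True
    have "Suc i * (m choose Suc i) = (m - i) * (m choose i)"
      by (simp only: binomial_absorb_comp binomial_absorption)
    then have "real (Suc i) * real (m choose Suc i) = real (m - i) * real (m choose i)"
      by (simp only: of_nat_mult [symmetric])
    then show ?thesis using True by (simp add: M_def of_nat_diff)
  qed (simp add: binomial_eq_0)
  define J where "J = real j"
  have b: "(J + 1) * b = (M - J) * a"
    using rat[of j] by (simp add: a_def b_def J_def add_ac)
  have c: "(J + 2) * c = (M - J - 1) * b"
    using rat[of "j + 1"] by (simp add: b_def c_def J_def algebra_simps)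
  have e: "(J + 3) * e = (M - J - 2) * c"
    using rat[of "j + 2"] by (simp add: c_def e_def J_def algebra_simps eval_nat_numeral)
  have M: "M > 0" using assms by (simp add: M_def)
  have n0: "narayana m k = a * b / M" "narayana m (k + 1) = b * c / M" "narayana m (k + 2) = c * e / M"
    using assms Suc by (simp_all add: narayana_def a_def b_def c_def e_def M_def eval_nat_numeral)
  have n1: "narayana (m + 1) (k + 1) = (a + b) * (b + c) / (M + 1)"
    "narayana (m + 1) (k + 2) = (b + c) * (c + e) / (M + 1)"
    using assms Suc by (simp_all add: narayana_def a_def b_def c_def e_def M_def eval_nat_numeral add_ac)
  have n2: "narayana (m + 2) (k + 2) = (a + 2 * b + c) * (b + 2 * c + e) / (M + 2)"
    using assms Suc by (simp_all add: narayana_def a_def b_def c_def e_def M_def eval_nat_numeral add_ac)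
  have *: "(M + 3) * ((a + 2 * b + c) * (b + 2 * c + e) / (M + 2)) =
      (2 * M + 3) * ((b + c) * (c + e) / (M + 1) + (a + b) * (b + c) / (M + 1))
      - (c * e - 2 * (b * c) + a * b)"
  proof -
    have J: "J + 1 \<noteq> 0" "J + 2 \<noteq> 0" "J + 3 \<noteq> 0" by (simp_all add: J_def)
    have M': "M + 1 \<noteq> 0" "M + 2 \<noteq> 0" using M by simp_all
    \<comment> \<open>With this \<open>x\<close> the four binomial coefficients become polynomial multiples of \<open>x\<close>, and each sum
      given by Pascal's rule acquires the factor \<open>M + 1\<close> or \<open>M + 2\<close> that cancels a denominator.\<close>
    define x where "x = a / ((J + 1) * (J + 2) * (J + 3))"
    have a': "a = (J + 1) * (J + 2) * (J + 3) * x" using J by (simp add: x_def)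
    have "(J + 1) * b = (J + 1) * ((M - J) * (J + 2) * (J + 3) * x)"
      unfolding b a' by algebra
    then have b': "b = (M - J) * (J + 2) * (J + 3) * x" using J by simp
    have "(J + 2) * c = (J + 2) * ((M - J - 1) * (M - J) * (J + 3) * x)"
      unfolding c b' by algebra
    then have c': "c = (M - J - 1) * (M - J) * (J + 3) * x" using J by simp
    have "(J + 3) * e = (J + 3) * ((M - J - 2) * (M - J - 1) * (M - J) * x)"
      unfolding e c' by algebra
    then have e': "e = (M - J - 2) * (M - J - 1) * (M - J) * x" using J by simp
    have ab: "a + b = (M + 1) * ((J + 2) * (J + 3) * x)" unfolding a' b' by algebra
    have bc: "b + c = (M + 1) * ((M - J) * (J + 3) * x)" unfolding b' c' by algebra
    have ce: "c + e = (M + 1) * ((M - J - 1) * (M - J) * x)" unfolding c' e' by algebra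
    have abc: "a + 2 * b + c = (M + 2) * ((M + 1) * (J + 3) * x)" unfolding a' b' c' by algebra
    have bce: "b + 2 * c + e = (M + 2) * ((M + 1) * (M - J) * x)" unfolding b' c' e' by algebra
    have q: "(k * P) * (k * Q) / k = k * P * Q" if "k \<noteq> 0" for k P Q :: real
      using that by simp
    have core: "(M + 3) * ((M + 2) * (M + 1) * (M + 1)) =
        (2 * M + 3) * ((M + 1) * (M - J - 1) * (M - J) + (M + 1) * (J + 2) * (J + 3))
        - ((M - J - 1) * (M - J - 1) * (M - J) * (M - J - 2)
           - 2 * ((M - J) * (J + 2) * (J + 3) * (M - J - 1))
           + (J + 1) * (J + 2) * (J + 2) * (J + 3))"
      by algebra
    define K where "K = (M - J) * (J + 3) * x * x"
    have t: "(M + 2) * ((M + 1) * (J + 3) * x) * ((M + 1) * (M - J) * x)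
        = K * ((M + 2) * (M + 1) * (M + 1))"
      "(M + 1) * ((M - J) * (J + 3) * x) * ((M - J - 1) * (M - J) * x)
        = K * ((M + 1) * (M - J - 1) * (M - J))"
      "(M + 1) * ((J + 2) * (J + 3) * x) * ((M - J) * (J + 3) * x)
        = K * ((M + 1) * (J + 2) * (J + 3))"
      "c * e = K * ((M - J - 1) * (M - J - 1) * (M - J) * (M - J - 2))"
      "b * c = K * ((M - J) * (J + 2) * (J + 3) * (M - J - 1))"
      "a * b = K * ((J + 1) * (J + 2) * (J + 2) * (J + 3))"
      unfolding a' b' c' e' K_def by (simp_all only: ac_simps)
    have lin: "w * (K * p) = w' * (K * p1 + K * p2) - (K * p3 - 2 * (K * p4) + K * p5)"
      if "w * p = w' * (p1 + p2) - (p3 - 2 * p4 + p5)" for w w' p p1 p2 p3 p4 p5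
      using arg_cong[OF that, of "\<lambda>y. K * y"] by (simp add: algebra_simps)
    show ?thesis
      unfolding ab bc ce abc bce q[OF M'(1)] q[OF M'(2)] t by (rule lin[OF core])
  qed
  have "M * (c * e / M - 2 * (b * c / M) + a * b / M) = c * e - 2 * (b * c) + a * b"
    using M by (simp add: algebra_simps)
  moreover have "real (m + 3) = M + 3" "real (2 * m + 3) = 2 * M + 3" "real m = M"
    by (simp_all add: M_def)
  ultimately show ?thesis unfolding n0 n1 n2 using * by (simp only:)
qed

text \<open>The polynomial with index 0 deviates from the general formula for the coefficients, but in the
  instance where it occurs, its factor \<open>m\<close> is 0.\<close>

lemma assoc_narayana_recurrence:
  "smult (real (m + 3)) (assoc_narayana (m + 2)) =
    smult (real (2 * m + 3)) ([:1, 1:] * assoc_narayana (m + 1))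
    - smult (real m) ([:1, -1:]\<^sup>2 * assoc_narayana m)"
proof (cases "m = 0")
  case True
  have 1: "assoc_narayana 1 = [:0, 1:]" by (simp add: assoc_narayana_def monom_altdef)
  have 2: "assoc_narayana 2 = [:0, 1, 1:]"
    by (simp add: assoc_narayana_def monom_altdef eval_nat_numeral)
  show ?thesis using True 1 2 by (simp add: numeral_2_eq_2)
next
  case False
  show ?thesis
  proof (rule poly_eqI)
    fix i :: nat
    consider "i = 0" | "i = 1" | k where "i = k + 2"
      by (metis One_nat_def Suc_1 add_2_eq_Suc' not0_implies_Suc)
    then show "coeff (smult (real (m + 3)) (assoc_narayana (m + 2))) i =
       coeff (smult (real (2 * m + 3)) ([:1, 1:] * assoc_narayana (m + 1))
    - smult (real m) ([:1, -1:]\<^sup>2 * assoc_narayana m)) i"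
    proof cases
      case 3
      then show ?thesis using False narayana_recurrence[of m k]
        by (simp add: coeff_assoc_narayana power2_eq_square coeff_pCons algebra_simps
          split: nat.split)
    qed (use False in \<open>simp_all add: coeff_assoc_narayana narayana_def power2_eq_square coeff_pCons algebra_simps
          split: nat.split\<close>)
  qed
qed

lemma poly_fls_0 [simp]: "poly_fls 0 x = 0"
  by (simp add: poly_fls_def)

lemma poly_fls_pCons [simp]: "poly_fls (pCons a p) x = fls_const a + x * poly_fls p x"
  by (simp add: poly_fls_def map_poly_pCons)

lemma poly_fls_add: "poly_fls (p + q) x = poly_fls p x + poly_fls q x"
  by (induction p q rule: poly_induct2) (simp_all add: fls_plus_const algebra_simps)

lemma poly_fls_smult: "poly_fls (smult c p) x = fls_const c * poly_fls p x"
  by (induction p) (simp_all add: algebra_simps flip: fls_const_mult_const)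

lemma poly_fls_mult: "poly_fls (p * q) x = poly_fls p x * poly_fls q x"
  by (induction p) (simp_all add: poly_fls_add poly_fls_smult algebra_simps)

lemma poly_fls_diff: "poly_fls (p - q) x = poly_fls p x - poly_fls q x"
  using poly_fls_add[of "p - q" q x] by simp

lemma fps_to_fls_poly_fps: "fps_to_fls (poly_fps p f) = poly_fls p (fps_to_fls f)"
  by (induction p) (simp_all add: poly_fps_def map_poly_pCons fls_times_fps_to_fls)

text \<open>The series \<open>\<Sum>d. y\<^sup>d N\<^sub>d\<^sub>-\<^sub>1(x) w\<^sup>d\<close> in \<open>w\<close>, the generating function of plane trees where each node
  contributes \<open>w y\<close> and each leaf an additional factor \<open>x\<close>. Laurent series as coefficients allow for the
  argument \<open>x = 1/u\<close>, and they form a field.\<close>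

definition narayana_gf :: "real fls \<Rightarrow> real fls \<Rightarrow> real fls fps" where
  "narayana_gf x y =
     Abs_fps (\<lambda>d. if d = 0 then 0 else y ^ d * poly_fls (assoc_narayana (d - 1)) x)"

text \<open>The decomposition at the root would give \<open>M = w x y + w y M / (1 - M)\<close>. Here this equation is
  derived from the explicit coefficients: the recurrence of the Narayana polynomials is the one in
  \<open>fps_square_of_recurrence\<close> for \<open>s = y (1 + x)\<close>, \<open>t = (y (1 - x))\<^sup>2\<close>.\<close>

lemma narayana_gf_quadratic:
  fixes x y :: "real fls"
  defines "M \<equiv> narayana_gf x y"
  shows "M * (1 - M) = fps_X * fps_const (x * y) + fps_X * fps_const (y * (1 - x)) * M"
proof -
  define N where "N m = poly_fls (assoc_narayana m) x" for m
  have M0: "fps_nth M 0 = 0" and M: "fps_nth M (Suc m) = y ^ Suc m * N m" for m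
    by (simp_all add: M_def narayana_gf_def N_def)
  have N0: "N 0 = x" and N1: "N 1 = x"
    by (simp_all add: N_def assoc_narayana_def monom_altdef)
  have N: "of_nat (m + 3) * N (m + 2) =
      of_nat (2 * m + 3) * (1 + x) * N (m + 1) - of_nat m * (1 - x)\<^sup>2 * N m" for m
  proof -
    have p: "poly_fls [:1, 1:] x = 1 + x" "poly_fls ([:1, -1:]\<^sup>2) x = (1 - x)\<^sup>2"
      by (simp_all add: poly_fls_mult power2_eq_square algebra_simps)
    show ?thesis
      using arg_cong[OF assoc_narayana_recurrence, of "\<lambda>p. poly_fls p x" m]
      unfolding poly_fls_smult poly_fls_diff poly_fls_mult p N_def [symmetric]
      by (simp only: fls_of_nat mult.assoc)
  qed
  define P where "P = fps_X * fps_const (y * (1 - x))"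
  \<comment> \<open>\<open>V\<close> is the square root of the discriminant of the quadratic equation for \<open>M\<close>.\<close>
  define V where "V = 1 - P - fps_const 2 * M"
  have "V\<^sup>2 = 1 - fps_const (2 * (y * (1 + x))) * fps_X + fps_const ((y * (1 - x))\<^sup>2) * fps_X\<^sup>2"
  proof (rule fps_square_of_recurrence)
    show "fps_nth V 0 = 1" by (simp add: V_def P_def M0)
    show "fps_nth V 1 = - (y * (1 + x))"
      using M[of 0] by (simp add: V_def P_def M0 N0 algebra_simps)
    fix n
    have V2: "fps_nth V (Suc (Suc n)) = - 2 * (y ^ Suc (Suc n) * N (Suc n))" for n
      by (simp add: V_def P_def M)
    have V1: "of_nat n * fps_nth V (Suc n) = - 2 * of_nat n * (y ^ Suc n * N n)" for n
      by (cases n) (simp_all add: V_def P_def M algebra_simps)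
    show "of_nat (n + 2) * fps_nth V (n + 2) =
        y * (1 + x) * of_nat (2 * n + 1) * fps_nth V (n + 1)
        - (y * (1 - x))\<^sup>2 * (of_nat n - 1) * fps_nth V n"
    proof (cases n)
      case 0
      then show ?thesis using N1 M[of 0] V2[of 0]
        by (simp add: V_def P_def M0 N0 power2_eq_square algebra_simps)
    next
      case (Suc m)
      have "of_nat (n + 2) * fps_nth V (n + 2) = - 2 * y ^ (m + 3) * (of_nat (m + 3) * N (m + 2))"
        using V2[of "Suc m"] Suc by (simp add: eval_nat_numeral mult_ac del: of_nat_Suc)
      also have "\<dots> = y * (1 + x) * of_nat (2 * m + 3) * (- 2 * (y ^ (m + 2) * N (m + 1)))
          - (y * (1 - x))\<^sup>2 * (- 2 * of_nat m * (y ^ Suc m * N m))"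
        unfolding N by (simp add: power2_eq_square eval_nat_numeral algebra_simps del: of_nat_Suc)
      also have "\<dots> = y * (1 + x) * of_nat (2 * n + 1) * fps_nth V (n + 1)
          - (y * (1 - x))\<^sup>2 * (of_nat m * fps_nth V n)"
        unfolding V1[symmetric] Suc using V2[of m] by (simp add: V1 eval_nat_numeral)
      finally show ?thesis using Suc by (simp add: mult.assoc)
    qed
  qed
  also have "fps_const (2 * (y * (1 + x))) * fps_X =
      fps_const 2 * P + fps_const 4 * (fps_X * fps_const (x * y))"
    by (simp add: P_def fps_eq_iff algebra_simps)
  also have "fps_const ((y * (1 - x))\<^sup>2) * fps_X\<^sup>2 = P\<^sup>2"
    by (simp add: P_def power_mult_distrib fps_const_power)
  finally have "4 * (M * (1 - M)) = 4 * (fps_X * fps_const (x * y) + P * M)"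
    unfolding V_def by (simp add: power2_eq_square algebra_simps flip: numeral_fps_const)
  then have "M * (1 - M) = fps_X * fps_const (x * y) + P * M"
    unfolding mult_cancel_left by simp
  then show ?thesis by (simp add: P_def)
qed

text \<open>A quadratic equation over power series in \<open>w\<close> whose coefficients are of degree 1 in \<open>w\<close> has
  just one solution with a given simple root \<open>c\<close> as constant term. After removing \<open>c\<close> and dividing by
  the distance \<open>k\<close> of the two roots at \<open>w = 0\<close>, the equation takes the form of
  \<open>narayana_gf_quadratic\<close>; comparing coefficients gives the two conditions on \<open>x\<close> and \<open>y\<close>.\<close>

lemma quadratic_solution_narayana:
  fixes S :: "real fls fps"
  assumes S: "(S - fps_X * fps_const e) * (1 - S) = fps_const z + fps_X * fps_const f"
    and S0: "fps_nth S 0 = c" and c: "c * (1 - c) = z" and k: "k = 1 - 2 * c" "k \<noteq> 0"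
    and xy: "k\<^sup>2 * (x * y) = f + e * (1 - c)" "k * (y * (1 - x)) = - e"
  shows "S = fps_const c + fps_const k * narayana_gf x y"
proof -
  define M where "M = narayana_gf x y"
  define R where "R = fps_const c + fps_const k * M"
  have q: "M * (1 - M) = fps_X * fps_const (x * y) + fps_X * fps_const (y * (1 - x)) * M"
    unfolding M_def by (rule narayana_gf_quadratic)
  define C K E Z F A B where "C = fps_const c" and "K = fps_const k" and "E = fps_const e"
    and "Z = fps_const z" and "F = fps_const f" and "A = fps_const (x * y)"
    and "B = fps_const (y * (1 - x))"
  note defs = C_def K_def E_def Z_def F_def A_def B_def
  have eqs: "C * (1 - C) = Z" "K = 1 - 2 * C" "K * K * A = F + E * (1 - C)" "K * B = - E"
    using arg_cong[OF c, of fps_const] arg_cong[OF k(1), of fps_const]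
      arg_cong[OF xy(1), of fps_const] arg_cong[OF xy(2), of fps_const]
    by (simp_all add: defs power2_eq_square numeral_fps_const flip: fps_const_1_eq_1)
  have R: "(R - fps_X * E) * (1 - R) = Z + fps_X * F"
    using q eqs unfolding R_def C_def[symmetric] K_def[symmetric] A_def[symmetric] B_def[symmetric]
    by algebra
  \<comment> \<open>Subtracting the two equations; at \<open>w = 0\<close> the cofactor is the difference \<open>k\<close> of the two
    roots.\<close>
  have "(S - R) * (1 - S - R + fps_X * E) = 0"
    using R S unfolding E_def[symmetric] Z_def[symmetric] F_def[symmetric] by algebra
  moreover have "fps_nth (1 - S - R + fps_X * E) 0 = k"
    by (simp add: S0 R_def M_def narayana_gf_def k(1) E_def)
  then have "1 - S - R + fps_X * E \<noteq> 0" using k(2) by (metis fps_zero_nth)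
  ultimately show ?thesis by (simp add: R_def M_def)
qed

section \<open>Exchanging the two variables of a double power series\<close>

text \<open>Power series in \<open>z\<close> over power series in \<open>w\<close> become series in \<open>w\<close> over Laurent series in \<open>z\<close>. The
  decomposition of trees is naturally expressed by the former, as each coefficient of \<open>z\<^sup>n\<close> is a finite sum; the
  Narayana polynomials are coefficients with respect to \<open>w\<close>.\<close>

definition transpose_fps :: "real fps fps \<Rightarrow> real fls fps" where
  "transpose_fps F = Abs_fps (\<lambda>d. fps_to_fls (Abs_fps (\<lambda>n. fps_nth (fps_nth F n) d)))"

lemma transpose_fps_add: "transpose_fps (F + H) = transpose_fps F + transpose_fps H"
  by (simp add: transpose_fps_def fps_eq_iff fls_eq_iff)

lemma transpose_fps_diff: "transpose_fps (F - H) = transpose_fps F - transpose_fps H"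
  by (simp add: transpose_fps_def fps_eq_iff fls_eq_iff)

lemma transpose_fps_const: "transpose_fps (fps_const c) = Abs_fps (\<lambda>d. fls_const (fps_nth c d))"
proof -
  have "Abs_fps (\<lambda>n. fps_nth (fps_nth (fps_const c) n) d) = fps_const (fps_nth c d)" for d
    by (simp add: fps_eq_iff)
  then show ?thesis by (simp add: transpose_fps_def)
qed

lemma transpose_fps_1: "transpose_fps 1 = 1"
  using transpose_fps_const[of 1] by (simp add: fps_eq_iff)

lemma transpose_fps_const_X: "transpose_fps (fps_const fps_X) = fps_X"
  by (simp add: transpose_fps_const fps_eq_iff)

lemma transpose_fps_lift:
  assumes "\<And>n. fps_nth F n = fps_const (fps_nth f n)"
  shows "transpose_fps F = fps_const (fps_to_fls f)"
proof -
  have "Abs_fps (\<lambda>n. fps_nth (fps_nth F n) d) = (if d = 0 then f else 0)" for d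
    by (simp add: assms fps_eq_iff)
  then show ?thesis by (simp add: transpose_fps_def fps_eq_iff)
qed

lemma transpose_fps_X: "transpose_fps fps_X = fps_const fls_X"
  using transpose_fps_lift[of fps_X fps_X] by simp

text \<open>Both products sum over the same pairs of splittings of the two exponents.\<close>

lemma transpose_fps_mult: "transpose_fps (F * H) = transpose_fps F * transpose_fps H"
proof (rule fps_ext)
  fix d
  have sum: "fps_to_fls (sum f I) = (\<Sum>i\<in>I. fps_to_fls (f i))" for f :: "nat \<Rightarrow> real fps" and I
    by (induction I rule: infinite_finite_induct) simp_all
  let ?r = "\<lambda>F d. Abs_fps (\<lambda>n. fps_nth (fps_nth F n) d)"
  have "?r (F * H) d = (\<Sum>i=0..d. ?r F i * ?r H (d - i))"
    by (rule fps_ext) (simp add: fps_mult_nth fps_sum_nth, rule sum.swap)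
  then have "fps_to_fls (?r (F * H) d) = (\<Sum>i=0..d. fps_to_fls (?r F i) * fps_to_fls (?r H (d - i)))"
    by (simp add: sum fls_times_fps_to_fls)
  then show "fps_nth (transpose_fps (F * H)) d = fps_nth (transpose_fps F * transpose_fps H) d"
    by (simp add: transpose_fps_def fps_mult_nth)
qed

lemma transpose_vanish_gf: "transpose_fps (vanish_gf r) = fps_const (fps_to_fls (vanish_gf r))"
proof (rule transpose_fps_lift)
  fix n
  have sum: "fps_const (sum f I) = (\<Sum>i\<in>I. fps_const (f i))" for f :: "ptree \<Rightarrow> real" and I
    by (rule fps_ext) (simp add: fps_sum_nth)
  have const: "fps_const (of_bool Q :: real) = of_bool Q" for Q
    by simp
  show "fps_nth (vanish_gf r) n = fps_const (fps_nth (vanish_gf r) n :: real)"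
    by (simp only: vanish_gf_def tree_gf_def fps_nth_Abs_fps sum const)
qed

section \<open>Quadratic equations for the binomial moments\<close>

text \<open>Since \<open>(1 + w)\<^sup>k = \<Sum>d. (k choose d) w\<^sup>d\<close>, the substitution \<open>v = 1 + w\<close> turns derivatives at \<open>v = 1\<close> into
  coefficients of powers of \<open>w\<close>.\<close>

definition binomial_moment_gf :: "(ptree \<Rightarrow> nat) \<Rightarrow> real fls fps" where
  "binomial_moment_gf Y = transpose_fps (tree_gf (\<lambda>t. (1 + fps_X) ^ Y t))"

lemma one_plus_X_power_nth: "fps_nth ((1 + fps_X :: real fps) ^ k) d = real (k choose d)"
  using fps_binomial_of_nat[of k, where 'a = real] by (metis fps_binomial_nth binomial_gbinomial)

lemma binomial_moment_gf_nth:
  "fls_nth (fps_nth (binomial_moment_gf Y) d) (int n) = (\<Sum>t\<in>plane_trees n. real (Y t choose d))"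
  by (simp add: binomial_moment_gf_def transpose_fps_def tree_gf_def fps_sum_nth one_plus_X_power_nth)

lemma binomial_moment_gf_0: "fps_nth (binomial_moment_gf Y) 0 = fps_to_fls (tree_gf (\<lambda>_. 1))"
  by (simp add: binomial_moment_gf_def transpose_fps_def tree_gf_def fps_sum_nth one_plus_X_power_nth)

lemma power_sum_list: "x ^ (\<Sum>t\<leftarrow>ts. Y t) = (\<Prod>t\<leftarrow>ts. x ^ Y t)" for x :: "'a::comm_monoid_mult"
  by (induction ts) (simp_all add: power_add)

text \<open>In terms of \<open>v = 1 + w\<close> this is \<open>S = v z / (1 - S) + (1 - v) b\<close>: every node that survives
  contributes a factor \<open>v\<close>. The second summand repairs the weight of the trees that vanish.\<close>

lemma binomial_moment_gf_X_quadratic: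
  fixes r :: nat
  defines "b \<equiv> fps_to_fls (vanish_gf r)" and "S \<equiv> binomial_moment_gf (X_rv r)"
  shows "(S - fps_X * fps_const (- b)) * (1 - S) = fps_const fls_X + fps_X * fps_const fls_X"
proof -
  define g where "g t = (1 + fps_X :: real fps) ^ X_rv r t" for t
  define P where "P = tree_gf (\<lambda>t. \<Prod>c\<leftarrow>children t. g c)"
  define K where "K = fps_const (fps_X :: real fps)"
  \<comment> \<open>The last term corrects the factor \<open>1 + w\<close> of the root if the root itself vanishes; the product
    over the children is then 1.\<close>
  have "g t = (1 + fps_X) * (\<Prod>c\<leftarrow>children t. g c) + - fps_X * of_bool (vanishes r t)" for t
  proof (cases t)
    case (Node ts)
    have "(\<Prod>c\<leftarrow>ts. g c) = 1" if "vanishes r (Node ts)"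
    proof -
      have "map g ts = map (\<lambda>_. 1) ts"
        using vanishes_children[OF that] by (auto simp: g_def X_rv_def)
      then show ?thesis by (simp add: map_replicate_const)
    qed
    then show ?thesis unfolding Node
      by (auto simp: g_def X_rv_Node power_add power_sum_list algebra_simps)
  qed
  then have "tree_gf g = fps_const (1 + fps_X) * P + fps_const (- fps_X) * vanish_gf r"
    unfolding P_def vanish_gf_def by (rule tree_gf_lincomb)
  also have "fps_const (1 + fps_X) = 1 + K" by (simp add: K_def flip: fps_const_add)
  also have "fps_const (- fps_X) = - K" by (simp add: K_def)
  finally have "(tree_gf g + K * vanish_gf r) * (1 - tree_gf g) = (1 + K) * (P * (1 - tree_gf g))"
    by (simp add: algebra_simps)
  also have "P * (1 - tree_gf g) = fps_X"
    unfolding P_def by (rule tree_gf_node)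
  finally have eq: "(tree_gf g + K * vanish_gf r) * (1 - tree_gf g) = (1 + K) * fps_X" .
  have S: "S = transpose_fps (tree_gf g)"
    by (simp add: S_def binomial_moment_gf_def g_def [abs_def])
  have "(S + fps_X * fps_const b) * (1 - S) = (1 + fps_X) * fps_const fls_X"
    using arg_cong[OF eq, of transpose_fps]
    by (simp only: transpose_fps_mult transpose_fps_add transpose_fps_diff transpose_fps_1
      transpose_fps_X transpose_fps_const_X transpose_vanish_gf K_def S b_def)
  moreover have "fps_const (- b) = - fps_const b" by simp
  ultimately show ?thesis
    by (simp only: mult_minus_right diff_minus_eq_add distrib_right mult_1_left)
qed

text \<open>In terms of \<open>v = 1 + w\<close> this is \<open>S = z / (1 - S) + (v - 1) (b (r + 1) - b r)\<close>: the root contributes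
  only for the trees of height exactly \<open>r\<close>, where it is the unique leaf that is left.\<close>

lemma binomial_moment_gf_L_quadratic:
  fixes r :: nat
  defines "b \<equiv> \<lambda>r. fps_to_fls (vanish_gf r)" and "S \<equiv> binomial_moment_gf (L_rv r)"
  shows "(S - fps_X * fps_const (b (Suc r) - b r)) * (1 - S) = fps_const fls_X + fps_X * fps_const 0"
proof -
  define g where "g t = (1 + fps_X :: real fps) ^ L_rv r t" for t
  define P where "P = tree_gf (\<lambda>t. \<Prod>c\<leftarrow>children t. g c)"
  define K where "K = fps_const (fps_X :: real fps)"
  \<comment> \<open>The indicator of the trees that are reduced to their root after exactly \<open>r\<close> deletions.\<close>
  define h where "h t = (of_bool (vanishes (Suc r) t) - of_bool (vanishes r t) :: real fps)" for t
  have "g t = 1 * (\<Prod>c\<leftarrow>children t. g c) + fps_X * h t" for t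
  proof (cases t)
    case (Node ts)
    have "(\<Prod>c\<leftarrow>ts. g c) = 1" if "vanishes (Suc r) (Node ts)"
    proof -
      have "map g ts = map (\<lambda>_. 1) ts"
        using that by (auto simp: g_def L_rv_def rho_iter_Suc_None_iff)
      then show ?thesis by (simp add: map_replicate_const)
    qed
    moreover have "g (Node ts) = (if vanishes (Suc r) (Node ts) \<and> \<not> vanishes r (Node ts)
        then 1 + fps_X else 1) * (\<Prod>c\<leftarrow>ts. g c)"
      by (simp add: g_def L_rv_Node power_add power_sum_list)
    ultimately show ?thesis unfolding Node using vanishes_Suc[of r "Node ts"]
      by (cases "vanishes r (Node ts)"; cases "vanishes (Suc r) (Node ts)")
        (simp_all add: h_def del: not_None_eq)
  qed
  then have "tree_gf g = fps_const 1 * P + fps_const fps_X * tree_gf h"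
    unfolding P_def by (rule tree_gf_lincomb)
  also have "tree_gf h = vanish_gf (Suc r) - vanish_gf r"
    by (rule fps_ext) (simp add: tree_gf_def h_def vanish_gf_def sum_subtractf)
  finally have "(tree_gf g - K * (vanish_gf (Suc r) - vanish_gf r)) * (1 - tree_gf g) = P * (1 - tree_gf g)"
    by (simp add: K_def algebra_simps)
  also have "P * (1 - tree_gf g) = fps_X"
    unfolding P_def by (rule tree_gf_node)
  finally have eq: "(tree_gf g - K * (vanish_gf (Suc r) - vanish_gf r)) * (1 - tree_gf g) = fps_X" .
  have S: "S = transpose_fps (tree_gf g)"
    by (simp add: S_def binomial_moment_gf_def g_def [abs_def])
  have "(S - fps_X * (fps_const (b (Suc r)) - fps_const (b r))) * (1 - S) = fps_const fls_X"
    using arg_cong[OF eq, of transpose_fps]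
    by (simp only: transpose_fps_mult transpose_fps_diff transpose_fps_1
      transpose_fps_X transpose_fps_const_X transpose_vanish_gf K_def S b_def)
  then show ?thesis by simp
qed

section \<open>Closed forms in the variable u\<close>

lemma u_substitution_functional_eq:
  assumes "u_substitution u"
  shows "fps_nth u 0 = 0" and "fps_X * (1 + u)\<^sup>2 = u"
proof -
  show u0: "fps_nth u 0 = 0" using assms by (simp add: u_substitution_def)
  then have c: "fps_nth ((1 + u)\<^sup>2) 0 \<noteq> 0" by simp
  have X: "fps_X = u * inverse ((1 + u)\<^sup>2)"
    using assms fps_divide_unit[OF c] by (simp add: u_substitution_def)
  have "fps_X * (1 + u)\<^sup>2 = u * (inverse ((1 + u)\<^sup>2) * (1 + u)\<^sup>2)"
    by (subst X) (rule mult.assoc)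
  then show "fps_X * (1 + u)\<^sup>2 = u"
    by (simp only: inverse_mult_eq_1[OF c] mult_1_right)
qed

lemma tree_gf_one_eq:
  assumes "u_substitution u"
  shows "(1 + u) * tree_gf (\<lambda>_. 1) = u"
proof -
  note u = u_substitution_functional_eq[OF assms]
  define T :: "real fps" where "T = tree_gf (\<lambda>_. 1)"
  have T: "T * (1 - T) = fps_X"
    unfolding T_def by (rule tree_gf_one)
  \<comment> \<open>The roots of the quadratic equation for \<open>T\<close> are \<open>u / (1 + u)\<close> and \<open>1 / (1 + u)\<close>; the second one
    has the wrong constant term.\<close>
  have "((1 + u) * T - u) * ((1 + u) * (1 - T) - u) = 0"
  proof -
    \<comment> \<open>The roots of the quadratic equation for \<open>T\<close> are \<open>u / (1 + u)\<close> and \<open>1 / (1 + u)\<close>; the second one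
    has the wrong constant term.\<close>
  have "((1 + u) * T - u) * ((1 + u) * (1 - T) - u) = (T * (1 - T)) * (1 + u)\<^sup>2 - u"
      by algebra
    then show ?thesis using T u(2) by simp
  qed
  moreover have "fps_nth ((1 + u) * (1 - T) - u) 0 = 1"
    using u(1) by (simp add: T_def tree_gf_def)
  then have "(1 + u) * (1 - T) - u \<noteq> 0" by (metis fps_zero_nth zero_neq_one)
  ultimately show ?thesis by (simp add: T_def)
qed

context
  fixes u :: "real fps" and U :: "real fls"
  assumes u: "u_substitution u"
  defines "U \<equiv> fps_to_fls u"
begin

lemma fls_X_eq_U: "fls_X * (1 + U)\<^sup>2 = U"
  using arg_cong[OF u_substitution_functional_eq(2)[OF u], of fps_to_fls]
  by (simp add: U_def fls_times_fps_to_fls power2_eq_square)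

lemma U_nonzero: "U \<noteq> 0" "1 + U \<noteq> 0"
proof -
  show "U \<noteq> 0" using fls_X_eq_U by auto
  then show "1 + U \<noteq> 0" using fls_X_eq_U by auto
qed

lemma one_minus_U_power_nonzero: "1 - U ^ Suc k \<noteq> 0"
proof -
  have "fps_nth (1 - u ^ Suc k) 0 = 1"
    using u_substitution_functional_eq(1)[OF u] by simp
  then have "1 - u ^ Suc k \<noteq> 0" by (metis fps_zero_nth zero_neq_one)
  moreover have "1 - U ^ Suc k = fps_to_fls (1 - u ^ Suc k)"
    by (simp only: U_def fps_to_fls_power fps_to_fls_minus fps_one_to_fls)
  ultimately show ?thesis by (metis fps_to_fls_eq_0_iff)
qed

lemma one_minus_U_nonzero: "1 - U \<noteq> 0"
  using one_minus_U_power_nonzero[of 0] by simp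

lemma tree_gf_one_U: "fps_to_fls (tree_gf (\<lambda>_. 1)) = U / (1 + U)"
  using arg_cong[OF tree_gf_one_eq[OF u], of fps_to_fls] U_nonzero
  by (simp add: U_def fls_times_fps_to_fls field_simps)

text \<open>The closed form of the continued fraction \<open>z / (1 - z / (1 - \<dots>))\<close> of depth \<open>r\<close>.\<close>

lemma vanish_gf_U:
  "fps_to_fls (vanish_gf r) = (U - U ^ Suc r) / ((1 + U) * (1 - U ^ Suc r))"
proof (induction r)
  case 0
  show ?case by (simp add: vanish_gf_0)
next
  case (Suc r)
  define q b b' where "q = U ^ Suc r" and "b = fps_to_fls (vanish_gf r :: real fps)"
    and "b' = fps_to_fls (vanish_gf (Suc r) :: real fps)"
  have nz: "1 + U \<noteq> 0" "1 - q \<noteq> 0" "1 - U * q \<noteq> 0"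
    using U_nonzero one_minus_U_power_nonzero[of r] one_minus_U_power_nonzero[of "Suc r"]
    by (simp_all add: q_def)
  have b: "b * ((1 + U) * (1 - q)) = U - q"
    using Suc nz by (simp add: q_def b_def)
  have "b' * (1 - b) = fls_X"
    using arg_cong[OF vanish_gf_Suc[of r, where 'a = real], of fps_to_fls]
    by (simp add: b_def b'_def fls_times_fps_to_fls)
  moreover have "1 - U * q = (1 + U) * (1 - q) * (1 - b)"
  proof -
    have "(1 + U) * (1 - q) * (1 - b) = (1 + U) * (1 - q) - b * ((1 + U) * (1 - q))"
      by (simp add: algebra_simps)
    then show ?thesis unfolding b by (simp add: algebra_simps)
  qed
  then have "b' * ((1 + U) * (1 - U * q)) = (b' * (1 - b)) * (1 + U)\<^sup>2 * (1 - q)"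
    by (simp add: power2_eq_square mult_ac)
  ultimately have "b' * ((1 + U) * (1 - U * q)) = U - U * q"
    by (simp add: fls_X_eq_U right_diff_distrib)
  then show ?case
    using nz by (simp add: q_def b'_def eq_divide_eq)
qed

text \<open>The data of \<open>quadratic_solution_narayana\<close> that do not depend on the statistic: at \<open>w = 0\<close> all trees have
  weight 1, so the constant term is \<open>U / (1 + U)\<close>.\<close>

lemma U_root:
  shows "U / (1 + U) * (1 - U / (1 + U)) = fls_X"
    and "(1 - U) / (1 + U) = 1 - 2 * (U / (1 + U))" and "(1 - U) / (1 + U) \<noteq> 0"
proof -
  have "fls_X = U / (1 + U)\<^sup>2"
    using fls_X_eq_U U_nonzero by (simp add: eq_divide_eq)
  then show "U / (1 + U) * (1 - U / (1 + U)) = fls_X"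
    using U_nonzero by (simp add: field_simps power2_eq_square)
  show "(1 - U) / (1 + U) = 1 - 2 * (U / (1 + U))"
    using U_nonzero by (simp add: field_simps)
  show "(1 - U) / (1 + U) \<noteq> 0"
    using U_nonzero one_minus_U_nonzero by simp
qed

text \<open>The arguments are determined by the two conditions on \<open>x\<close>, \<open>y\<close> with \<open>e = - b\<close> and \<open>f = z\<close>: the first
  yields \<open>x y\<close>, the second \<open>y (1 - x)\<close>, and the sum of these is \<open>y\<close>.\<close>

lemma binomial_moment_gf_X_eq:
  "binomial_moment_gf (X_rv r) = fps_const (U / (1 + U)) + fps_const ((1 - U) / (1 + U)) *
     narayana_gf (U ^ r) (U / ((1 - U ^ (r + 1)) * (1 - U)))"
proof (rule quadratic_solution_narayana[OF binomial_moment_gf_X_quadratic _ U_root])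
  show "fps_nth (binomial_moment_gf (X_rv r)) 0 = U / (1 + U)"
    by (simp only: binomial_moment_gf_0 tree_gf_one_U)
  define q where "q = U ^ Suc r"
  have nz: "1 + U \<noteq> 0" "1 - U \<noteq> 0" "1 - q \<noteq> 0"
    using U_nonzero one_minus_U_nonzero one_minus_U_power_nonzero[of r] by (simp_all add: q_def)
  have b: "fps_to_fls (vanish_gf r) = (U - q) / ((1 + U) * (1 - q))"
    by (simp add: vanish_gf_U q_def)
  have X: "fls_X = U / (1 + U)\<^sup>2"
    using fls_X_eq_U U_nonzero by (simp add: eq_divide_eq)
  have xy: "U ^ r * (U / ((1 - U ^ (r + 1)) * (1 - U))) = q / ((1 - q) * (1 - U))"
    by (simp add: q_def)
  have y: "U / ((1 - U ^ (r + 1)) * (1 - U)) * (1 - U ^ r) = (U - q) / ((1 - q) * (1 - U))"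
  proof -
    have "U * (1 - U ^ r) = U - q" by (simp add: q_def right_diff_distrib)
    then show ?thesis by (simp only: times_divide_eq_left q_def Suc_eq_plus1)
  qed
  show "((1 - U) / (1 + U))\<^sup>2 * (U ^ r * (U / ((1 - U ^ (r + 1)) * (1 - U)))) =
      fls_X + - fps_to_fls (vanish_gf r) * (1 - U / (1 + U))"
    unfolding xy b X using nz by (simp add: divide_simps power2_eq_square) algebra
  show "(1 - U) / (1 + U) * (U / ((1 - U ^ (r + 1)) * (1 - U)) * (1 - U ^ r)) =
      - (- fps_to_fls (vanish_gf r))"
    unfolding y b using nz by (simp add: divide_simps)
qed

text \<open>Here \<open>f = 0\<close>, and \<open>e = b (r + 1) - b r\<close> is a common factor of both conditions. Their quotient
  gives \<open>x = 1 / U\<close> for every \<open>r\<close>.\<close>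

lemma binomial_moment_gf_L_eq:
  "binomial_moment_gf (L_rv r) = fps_const (U / (1 + U)) + fps_const ((1 - U) / (1 + U)) *
     narayana_gf (1 / U) (U ^ (r + 2) / ((1 - U ^ (r + 2)) * (1 - U ^ (r + 1))))"
proof (rule quadratic_solution_narayana[OF binomial_moment_gf_L_quadratic _ U_root])
  show "fps_nth (binomial_moment_gf (L_rv r)) 0 = U / (1 + U)"
    by (simp only: binomial_moment_gf_0 tree_gf_one_U)
  define q where "q = U ^ Suc r"
  have nz: "U \<noteq> 0" "1 + U \<noteq> 0" "1 - U \<noteq> 0" "1 - q \<noteq> 0" "1 - U * q \<noteq> 0"
    using U_nonzero one_minus_U_nonzero one_minus_U_power_nonzero[of r]
      one_minus_U_power_nonzero[of "Suc r"] by (simp_all add: q_def)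
  have e: "fps_to_fls (vanish_gf (Suc r)) - fps_to_fls (vanish_gf r) =
      q * (1 - U)\<^sup>2 / ((1 + U) * (1 - q) * (1 - U * q))"
  proof -
    have "fps_to_fls (vanish_gf (Suc r)) - fps_to_fls (vanish_gf r) =
      (U - U * q) / ((1 + U) * (1 - U * q)) - (U - q) / ((1 + U) * (1 - q))"
      by (simp add: vanish_gf_U q_def)
    also have "\<dots> = q * (1 - U)\<^sup>2 / ((1 + U) * (1 - q) * (1 - U * q))"
      using nz by (simp add: divide_simps power2_eq_square) algebra
    finally show ?thesis .
  qed
  have y: "U ^ (r + 2) / ((1 - U ^ (r + 2)) * (1 - U ^ (r + 1))) = U * q / ((1 - U * q) * (1 - q))"
    by (simp add: q_def)
  show "((1 - U) / (1 + U))\<^sup>2 *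
      (1 / U * (U ^ (r + 2) / ((1 - U ^ (r + 2)) * (1 - U ^ (r + 1))))) =
      0 + (fps_to_fls (vanish_gf (Suc r)) - fps_to_fls (vanish_gf r)) * (1 - U / (1 + U))"
    unfolding y e using nz by (simp add: divide_simps power2_eq_square)
  show "(1 - U) / (1 + U) *
      (U ^ (r + 2) / ((1 - U ^ (r + 2)) * (1 - U ^ (r + 1))) * (1 - 1 / U)) =
      - (fps_to_fls (vanish_gf (Suc r)) - fps_to_fls (vanish_gf r))"
    unfolding y e using nz by (simp add: divide_simps power2_eq_square) algebra
qed

end

section \<open>Factorial moments\<close>

lemma falling_factorial_of_nat: "falling_factorial (real k) d = fact d * real (k choose d)"
  by (simp add: falling_factorial_def binomial_gbinomial gbinomial_mult_fact atLeast0LessThan)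

lemma factorial_moment_eq_sum:
  assumes "n \<ge> 1"
  shows "factorial_moment d n Y =
    1 / catalan (n - 1) * (\<Sum>t\<in>plane_trees n. falling_factorial (real (Y t)) d)"
  unfolding factorial_moment_def random_plane_tree_def
  using assms card_plane_trees[OF assms]
  by (subst integral_pmf_of_set) (simp_all add: plane_trees_nonempty finite_plane_trees)

lemma factorial_moment_eq_binomial_moment_gf:
  assumes "n \<ge> 1"
  shows "factorial_moment d n Y =
    1 / catalan (n - 1) * fls_nth (fact d * fps_nth (binomial_moment_gf Y) d) (int n)"
proof -
  have fact: "(fact d :: real fls) = fls_const (fact d)"
    using fls_of_nat[of "fact d", where 'a = real] by simp
  show ?thesis
    unfolding factorial_moment_eq_sum[OF assms] fact
    by (simp add: binomial_moment_gf_nth falling_factorial_of_nat sum_distrib_left)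
qed

lemma poly_pderiv_funpow_monom:
  "poly ((pderiv ^^ d) (monom c m)) 1 = c * falling_factorial (real m) d"
proof (induction d arbitrary: c m)
  case 0
  then show ?case by (simp add: poly_monom falling_factorial_def)
next
  case (Suc d)
  have "poly ((pderiv ^^ Suc d) (monom c m)) 1 = real m * c * falling_factorial (real (m - 1)) d"
    by (simp add: funpow_Suc_right pderiv_monom Suc del: funpow.simps)
  also have "\<dots> = c * falling_factorial (real m) (Suc d)"
    by (cases m) (simp_all add: falling_factorial_def prod.lessThan_Suc_shift del: prod.lessThan_Suc)
  finally show ?case .
qed

lemma deriv_v_funpow_nth: "fps_nth ((deriv_v ^^ d) F) n = (pderiv ^^ d) (fps_nth F n)"
  by (induction d) (simp_all add: deriv_v_def)

lemma eval_deriv_G_nth: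
  assumes "d \<ge> 1"
  shows "fps_nth (eval_v ((deriv_v ^^ d) (G r)) 1) n =
    (\<Sum>t\<in>plane_trees n. falling_factorial (real (X_rv r t)) d)"
proof -
  have "fps_nth (eval_v ((deriv_v ^^ d) (G r)) 1) n =
      (\<Sum>t\<in>{t \<in> plane_trees n. \<not> vanishes r t}. falling_factorial (real (X_rv r t)) d)"
    by (auto simp: eval_v_def deriv_v_funpow_nth G_def higher_pderiv_sum poly_sum
      poly_pderiv_funpow_monom X_rv_def intro!: sum.cong)
  \<comment> \<open>A vanishing tree has \<open>X_rv r t = 0\<close>, whose falling factorial is 0 because \<open>d \<ge> 1\<close>.\<close>
  also have "\<dots> = (\<Sum>t\<in>plane_trees n. falling_factorial (real (X_rv r t)) d)"
    using assms
    by (intro sum.mono_neutral_left)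
      (auto simp: finite_plane_trees X_rv_def falling_factorial_of_nat simp del: of_nat_0
        intro!: prod_zero split: option.splits)
  finally show ?thesis .
qed

theorem proposition2p9:
  fixes d n :: nat and u :: "real fps"
  assumes "d \<ge> 1" and "n \<ge> 1" and "u_substitution u"
  shows
    "(\<forall>r.
       factorial_moment d n (X_rv r) =
         1 / catalan (n - 1) * fps_nth (eval_v ((deriv_v ^^ d) (G r)) 1) n
     \<and> factorial_moment d n (X_rv r) =
         1 / catalan (n - 1) *
           fps_nth
             (u ^ d * fact d / ((1 + u) * (1 - u ^ (r + 1)) ^ d * (1 - u) ^ (d - 1))
               * poly_fps (assoc_narayana (d - 1)) (u ^ r)) n
     \<and> factorial_moment d n (L_rv r) =
         1 / catalan (n - 1) *
           fls_nth
             (let U = fps_to_fls u in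
              U ^ (d * r + 2 * d) * (1 - U) * fact d
                / ((1 + U) * (1 - U ^ (r + 2)) ^ d * (1 - U ^ (r + 1)) ^ d)
                * poly_fls (assoc_narayana (d - 1)) (1 / U)) (int n))
     \<and> (\<forall>r\<ge>1. factorial_moment d n (I_rv (r - 1)) = factorial_moment d n (X_rv r))"
proof -
  define U where "U = fps_to_fls u"
  note u = \<open>u_substitution u\<close>
  have u0: "fps_nth u 0 = 0" by (rule u_substitution_functional_eq(1)[OF u])
  have nz: "1 - U \<noteq> 0" using one_minus_U_nonzero[OF u] by (simp add: U_def)
  have X1: "factorial_moment d n (X_rv r) =
      1 / catalan (n - 1) * fps_nth (eval_v ((deriv_v ^^ d) (G r)) 1) n" for r
    using assms by (simp add: eval_deriv_G_nth factorial_moment_eq_sum)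
  have X2: "factorial_moment d n (X_rv r) = 1 / catalan (n - 1) *
      fps_nth (u ^ d * fact d / ((1 + u) * (1 - u ^ (r + 1)) ^ d * (1 - u) ^ (d - 1))
               * poly_fps (assoc_narayana (d - 1)) (u ^ r)) n" for r
  proof -
    define N where "N = poly_fls (assoc_narayana (d - 1)) (U ^ r)"
    let ?D = "(1 + u) * (1 - u ^ (r + 1)) ^ d * (1 - u) ^ (d - 1)"
    \<comment> \<open>A unit as denominator, so that the quotient of power series agrees with the one of Laurent
      series.\<close>
    have "fps_nth ?D 0 = 1" using u0 by (simp add: fps_power_zeroth)
    then have sub: "subdegree ?D = 0" by (simp add: subdegree_eq_0_iff)
    have fact: "fps_to_fls (fact d :: real fps) = fact d"
      using fps_to_fls_of_nat[of "fact d", where 'a = real] by simp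
    have "fps_to_fls (u ^ d * fact d / ?D * poly_fps (assoc_narayana (d - 1)) (u ^ r)) =
        U ^ d * fact d / ((1 + U) * (1 - U ^ (r + 1)) ^ d * (1 - U) ^ (d - 1)) * N"
    proof -
      have "fps_to_fls (u ^ d * fact d / ?D) = fps_to_fls (u ^ d * fact d) / fps_to_fls ?D"
        by (rule fls_divide_fps_to_fls [symmetric]) (simp only: sub le0)
      then show ?thesis
        by (simp only: fls_times_fps_to_fls fps_to_fls_poly_fps fps_to_fls_power fps_to_fls_plus
          fps_to_fls_minus fps_one_to_fls U_def N_def fact)
    qed
    also have "\<dots> = fact d * ((1 - U) / (1 + U) * ((U / ((1 - U ^ (r + 1)) * (1 - U))) ^ d * N))"
    proof -
      \<comment> \<open>The factor \<open>1 - U\<close> of the scaling turns the exponent \<open>d\<close> of \<open>1 - U\<close> into \<open>d - 1\<close>.\<close>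
      have "(1 - U) ^ d = (1 - U) * (1 - U) ^ (d - 1)"
        using assms by (metis power_eq_if not_one_le_zero)
      then show ?thesis using nz by (simp add: power_divide power_mult_distrib mult_ac)
    qed
    also have "\<dots> = fact d * fps_nth (binomial_moment_gf (X_rv r)) d"
      using assms by (simp add: binomial_moment_gf_X_eq[OF u] narayana_gf_def N_def U_def)
    finally have "fact d * fps_nth (binomial_moment_gf (X_rv r)) d =
        fps_to_fls (u ^ d * fact d / ?D * poly_fps (assoc_narayana (d - 1)) (u ^ r))" ..
    then show ?thesis
      unfolding factorial_moment_eq_binomial_moment_gf[OF \<open>n \<ge> 1\<close>] by simp
  qed
  have L: "factorial_moment d n (L_rv r) = 1 / catalan (n - 1) * fls_nth
             (let U = fps_to_fls u in
              U ^ (d * r + 2 * d) * (1 - U) * fact d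
                / ((1 + U) * (1 - U ^ (r + 2)) ^ d * (1 - U ^ (r + 1)) ^ d)
                * poly_fls (assoc_narayana (d - 1)) (1 / U)) (int n)" for r
  proof -
    define N where "N = poly_fls (assoc_narayana (d - 1)) (1 / U)"
    have "d * r + 2 * d = (r + 2) * d" by (simp add: algebra_simps)
    then have "U ^ (d * r + 2 * d) = (U ^ (r + 2)) ^ d"
      by (simp only: power_mult)
    then have "U ^ (d * r + 2 * d) * (1 - U) * fact d
        / ((1 + U) * (1 - U ^ (r + 2)) ^ d * (1 - U ^ (r + 1)) ^ d) * N =
        fact d * ((1 - U) / (1 + U) *
          ((U ^ (r + 2) / ((1 - U ^ (r + 2)) * (1 - U ^ (r + 1)))) ^ d * N))"
      by (simp only: power_divide power_mult_distrib times_divide_eq_left times_divide_eq_right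
        divide_divide_eq_left ac_simps)
    also have "\<dots> = fact d * fps_nth (binomial_moment_gf (L_rv r)) d"
      using assms by (simp add: binomial_moment_gf_L_eq[OF u] narayana_gf_def N_def U_def)
    finally show ?thesis
      unfolding factorial_moment_eq_binomial_moment_gf[OF \<open>n \<ge> 1\<close>] Let_def
      by (simp only: U_def N_def)
  qed
  have I: "factorial_moment d n (I_rv (r - 1)) = factorial_moment d n (X_rv r)" if "r \<ge> 1" for r
  proof -
    have "I_rv (r - 1) = X_rv r" using that by (simp add: fun_eq_iff I_rv_eq_X_rv)
    then show ?thesis by simp
  qed
  show ?thesis using X1 X2 L I by blast
qed

end
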